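(* For every integer $c\ge1$ there is a finite connected graph with minimum degree $c$ that is strongly non-stackable.
   Context: Cup stacking on a finite connected graph: initially one cup on every vertex; a move takes all $r\ge1$ cups from a vertex $x$ onto a vertex $y\neq x$ that already carries at least one cup and satisfies $d(x,y)=r$ (shortest-path distance). A graph is $t$-stackable if some sequence of moves ends with all cups on $t$; it is strongly non-stackable if it is not $t$-stackable for any vertex $t$. *)

theory Defs
  imports "Graph_Theory.Graph_Theory"
begin

text \<open>The shortest-path distance is the library's minimal walk cost for unit arc weights
  (an extended real, infinite between different components).\<close>

abbreviation graph_dist :: "('a, 'b) pre_digraph \<Rightarrow> 'a \<Rightarrow> 'a \<Rightarrow> ereal" where
  "graph_dist G \<equiv> wf_digraph.\<mu> G (\<lambda>_. 1)"

definition min_degree :: "('a, 'b) pre_digraph \<Rightarrow> nat" where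
  "min_degree G = Min (out_degree G ` verts G)"

text \<open>A configuration assigns to each vertex the number of cups on it.\<close>

definition init_cups :: "('a, 'b) pre_digraph \<Rightarrow> 'a \<Rightarrow> nat" where
  "init_cups G = (\<lambda>v. if v \<in> verts G then 1 else 0)"

definition cup_move :: "('a, 'b) pre_digraph \<Rightarrow> ('a \<Rightarrow> nat) \<Rightarrow> ('a \<Rightarrow> nat) \<Rightarrow> bool" where
  "cup_move G f f' \<longleftrightarrow>
     (\<exists>x\<in>verts G. \<exists>y\<in>verts G. x \<noteq> y \<and> f x \<ge> 1 \<and> f y \<ge> 1 \<and>
        graph_dist G x y = ereal (real (f x)) \<and>
        f' = f(x := 0, y := f y + f x))"

definition stackable :: "('a, 'b) pre_digraph \<Rightarrow> 'a \<Rightarrow> bool" where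
  "stackable G t \<longleftrightarrow> t \<in> verts G \<and>
     (\<exists>f. (cup_move G)\<^sup>*\<^sup>* (init_cups G) f \<and> (\<forall>v\<in>verts G - {t}. f v = 0))"

definition strongly_non_stackable :: "('a, 'b) pre_digraph \<Rightarrow> bool" where
  "strongly_non_stackable G \<longleftrightarrow> (\<forall>t\<in>verts G. \<not> stackable G t)"

end

theory Submission
  imports Defs
begin

text \<open>Four cells of vertices, joined like the path on four vertices: two core cells of
  size \<open>c\<close> in the middle and two huge cells of leaves at the ends. The core is a vertex cover and
  the diameter is at most 3. A stack of more than three cups can never move again, and as long
  as the target is not emptied, every stack of at least two cups elsewhere contains a cup that
  started in the core. Hence the core can only help to clear a bounded number of leaves, but every
  target has a whole cell of leaves that are not adjacent to it.\<close>

context fin_digraph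
begin

text \<open>A finite distance is attained by a path, whose cost under unit weights is its length; a
  path of length 1 is a single arc.\<close>

lemma graph_dist_eq_1_imp_adj:
  assumes "graph_dist G x y = 1" and "x \<noteq> y"
  shows "x \<rightarrow>\<^bsub>G\<^esub> y"
proof -
  have "x \<rightarrow>\<^sup>* y"
    using assms(1) by (simp flip: \<mu>_reach_conv[where f = "\<lambda>_. 1"])
  then obtain p where p: "apath x p y" "graph_dist G x y = awalk_cost (\<lambda>_. 1) p"
    using min_cost_awalk[of x y "\<lambda>_. 1"] by auto
  have "awalk_cost (\<lambda>_. 1) p = real (length p)"
    by (simp add: awalk_cost_def sum_list_triv)
  with p(2) assms(1) have "length p = 1"
    by (simp add: one_ereal_def)
  then obtain e where "p = [e]"
    by (auto simp: length_Suc_conv)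
  with p(1) show ?thesis
    by (auto simp: apath_def awalk_simps intro: in_arcs_imp_in_arcs_ends)
qed

text \<open>The invariant is the sign of a potential: a stack that contains a core cup counts one more
  than the number of cups it can still take and move, an untouched leaf in \<open>L\<close> counts \<open>-1\<close>.
  No move increases the sum, unless it empties the target, which can then never be refilled.\<close>

lemma not_stackable_if_vertex_cover:
  assumes cover: "\<And>x y. x \<rightarrow>\<^bsub>G\<^esub> y \<Longrightarrow> x \<in> K \<or> y \<in> K"
    and K: "K \<subseteq> verts G"
    and diam: "\<And>x y. x \<in> verts G \<Longrightarrow> y \<in> verts G \<Longrightarrow> graph_dist G x y \<le> ereal (real D)"
    and L: "L \<subseteq> verts G - K - {t}" "\<And>x. x \<in> L \<Longrightarrow> \<not> x \<rightarrow>\<^bsub>G\<^esub> t"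
    and big: "D * card K < card L"
  shows "\<not> stackable G t"
proof
  assume "stackable G t"
  then obtain f where t: "t \<in> verts G" and f: "(cup_move G)\<^sup>*\<^sup>* (init_cups G) f"
    and empty: "\<forall>v\<in>verts G - {t}. f v = 0"
    by (auto simp: stackable_def)
  \<comment> \<open>Origins of cups need no record: off \<open>t\<close>, every stack of two or more
    is priced as containing a core cup. Cups on \<open>t\<close> weigh 0, so the desired final
    configuration has weight 0.\<close>
  define w :: "'a \<Rightarrow> nat \<Rightarrow> int" where
    "w v k = (if v = t \<or> k = 0 then 0
              else if k = 1 \<and> v \<notin> K then - of_bool (v \<in> L)
              else int D + 1 - int k)" for v k
  define W where "W g = (\<Sum>v\<in>verts G. w v (g v))" for g :: "'a \<Rightarrow> nat"
  \<comment> \<open>The first conjunct is what refutes the alternative \<open>f t = 0\<close> at the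
    end, when every other vertex is empty.\<close>
  have "(\<exists>v\<in>verts G. f v \<noteq> 0) \<and> (f t = 0 \<or> W f < 0)"
    using f
  proof (induction rule: rtranclp_induct)
    case base
    have "W (init_cups G) = (\<Sum>v\<in>verts G. w v 1)"
      by (simp add: W_def init_cups_def)
    \<comment> \<open>Only an inequality, because \<open>t\<close> may lie in \<open>K\<close> and
      then weighs 0 instead of \<open>D\<close>.\<close>
    also have "\<dots> \<le> (\<Sum>v\<in>verts G. int D * of_bool (v \<in> K) - of_bool (v \<in> L))"
      using L(1) by (intro sum_mono) (auto simp: w_def)
    also have "\<dots> = int D * int (card K) - int (card L)"
      using K L(1) by (auto simp: sum_subtractf simp flip: sum_distrib_left
          intro!: arg_cong2[where f = "(-)"] arg_cong2[where f = "(*)"] arg_cong[where f = card])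
    also have "\<dots> < 0"
      using big by (simp flip: of_nat_mult)
    finally show ?case
      using t by (auto simp: init_cups_def)
  next
    case (step g h)
    then obtain x y where xy: "x \<in> verts G" "y \<in> verts G" "x \<noteq> y" "g x \<ge> 1" "g y \<ge> 1"
      and d: "graph_dist G x y = ereal (real (g x))"
      and h: "h = g(x := 0, y := g y + g x)"
      by (auto simp: cup_move_def)
    have gx: "g x \<le> D"
      using diam[of x y] xy d by simp
    have adj: "x \<rightarrow>\<^bsub>G\<^esub> y" if "g x = 1"
      using that d xy graph_dist_eq_1_imp_adj[of x y] by (simp add: one_ereal_def)
    have "h t = 0 \<or> W h < 0"
    proof (cases "g t = 0 \<or> x = t")
      case True
      then show ?thesis
        using xy h by auto
    next
      case False
      have split: "W k = w x (k x) + w y (k y) + (\<Sum>v\<in>verts G - {x, y}. w v (k v))" for k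
      proof -
        have "W k = (\<Sum>v\<in>{x, y}. w v (k v)) + (\<Sum>v\<in>verts G - {x, y}. w v (k v))"
          unfolding W_def using xy by (subst sum.subset_diff[of "{x, y}"]) auto
        then show ?thesis
          using xy by simp
      qed
      \<comment> \<open>If \<open>y = t\<close>, the weight lost at \<open>x\<close> is nonnegative:
        \<open>g x\<close> is at most \<open>D\<close>, and a lone cup in \<open>L\<close> is not
        adjacent to \<open>t\<close>. Otherwise \<open>cover\<close> forbids merging two lone cups
        from outside \<open>K\<close>; merging one such cup with a core stack removes a weight of at
        least -1 but uses up one unit of capacity. Merging two core stacks loses
        \<open>D + 1\<close>.\<close>
      have "w x (h x) + w y (h y) \<le> w x (g x) + w y (g y)"
        using False xy gx adj cover[of x y] L(2)[of x] L(1) h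
        by (auto simp: w_def)
      moreover have "(\<Sum>v\<in>verts G - {x, y}. w v (h v)) = (\<Sum>v\<in>verts G - {x, y}. w v (g v))"
        by (intro sum.cong) (auto simp: h)
      ultimately have "W h \<le> W g"
        by (simp add: split)
      then show ?thesis
        using step.IH False by auto
    qed
    moreover have "h y \<noteq> 0"
      using xy h by auto
    ultimately show ?case
      using xy by blast
  qed
  moreover have "W f = 0"
    unfolding W_def by (intro sum.neutral) (use empty in \<open>force simp: w_def\<close>)
  ultimately obtain v where "v \<in> verts G" "f v \<noteq> 0" "f t = 0"
    by auto
  then show False
    using empty by force
qed

end

text \<open>The core consists of the vertices below \<open>2 * c\<close>; parity tells the two halves apart.
  Each half has \<open>7 * c\<close> leaves, more than diameter times core size, \<open>3 * (2 * c)\<close>.\<close>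

definition double_star :: "nat \<Rightarrow> nat pair_pre_digraph" where
  "double_star c = \<lparr> pverts = {..<16 * c},
     parcs = {(u, v). u < 16 * c \<and> v < 16 * c \<and>
       (if even u = even v then (u < 2 * c) \<noteq> (v < 2 * c) else u < 2 * c \<and> v < 2 * c)} \<rparr>"

lemma pverts_double_star [simp]: "pverts (double_star c) = {..<16 * c}"
  by (simp add: double_star_def)

lemma parcs_double_star [simp]:
  "(u, v) \<in> parcs (double_star c) \<longleftrightarrow> u < 16 * c \<and> v < 16 * c \<and>
     (if even u = even v then (u < 2 * c) \<noteq> (v < 2 * c) else u < 2 * c \<and> v < 2 * c)"
  by (simp add: double_star_def)

lemma pair_graph_double_star: "pair_graph (double_star c)"
proof
  show "finite (parcs (double_star c))"
    by (rule finite_subset[of _ "{..<16 * c} \<times> {..<16 * c}"]) auto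
  show "symmetric (double_star c)"
    by (auto simp: symmetric_def sym_def)
qed (auto split: if_splits)

text \<open>Used with \<open>c\<close> for a core cell and with \<open>8 * c\<close> for a whole
  half, core and leaves together.\<close>

lemma card_same_parity:
  "card {u. u < 2 * c \<and> (even u \<longleftrightarrow> b)} = c"
proof -
  have "{u. u < 2 * c \<and> (even u \<longleftrightarrow> b)} = (\<lambda>i. 2 * i + of_bool (\<not> b)) ` {..<c}"
    by (cases b) (auto elim!: evenE oddE, presburger)
  then show ?thesis
    by (simp add: card_image inj_on_def)
qed

text \<open>Gives both the diameter bound and connectedness.\<close>

lemma double_star_awalk:
  assumes "u < 16 * c" and "v < 16 * c"
  shows "\<exists>p. pre_digraph.awalk (double_star c) u p v \<and> length p \<le> 3"
proof -
  interpret pair_graph "double_star c"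
    by (rule pair_graph_double_star)
  \<comment> \<open>These are 0 or 1, core vertices in the halves of \<open>u\<close> and
    \<open>v\<close>; \<open>1 - i\<close> is a core vertex in the half opposite to
    \<open>u\<close>. Only leaves of different halves need three arcs.\<close>
  define i j where "i = u mod 2" and "j = v mod 2"
  have ij: "i < 2 * c" "j < 2 * c" "even i = even u" "even j = even v"
    using assms mod_less_divisor[of 2 u] mod_less_divisor[of 2 v]
    by (auto simp: i_def j_def intro: less_le_trans[of _ 2])
  have flip: "1 - i < 2 * c" "even (1 - i) \<longleftrightarrow> odd u"
    using assms by (cases c; auto simp: i_def mod_2_eq_odd)+
  define p where "p =
    (if even u = even v then
       if (u < 2 * c) \<noteq> (v < 2 * c) then [(u, v)]
       else if u < 2 * c then [(u, 1 - i), (1 - i, v)]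
       else [(u, i), (i, v)]
     else if u < 2 * c then if v < 2 * c then [(u, v)] else [(u, j), (j, v)]
     else if v < 2 * c then [(u, i), (i, v)] else [(u, i), (i, j), (j, v)])"
  have "awalk u p v" "length p \<le> 3"
    using assms ij flip by (auto simp: p_def awalk_Cons_iff awalk_Nil_iff)
  then show ?thesis
    by blast
qed

text \<open>A leaf sees exactly the core cell of its own parity, a core vertex at least the core
  cell of the other parity; each has \<open>c\<close> vertices.\<close>

lemma min_degree_double_star:
  assumes "c \<ge> 1"
  shows "min_degree (double_star c) = c"
proof -
  interpret pair_graph "double_star c"
    by (rule pair_graph_double_star)
  have deg: "out_degree (double_star c) u = card {v. (u, v) \<in> parcs (double_star c)}" for u
  proof -
    have "out_arcs (double_star c) u = Pair u ` {v. (u, v) \<in> parcs (double_star c)}"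
      by (auto simp: out_arcs_def simp del: parcs_double_star)
    then show ?thesis
      by (simp add: out_degree_def card_image inj_on_def)
  qed
  have leaf: "out_degree (double_star c) u = c" if "2 * c \<le> u" "u < 16 * c" for u
  proof -
    have "{v. (u, v) \<in> parcs (double_star c)} = {v. v < 2 * c \<and> (even v \<longleftrightarrow> even u)}"
      using that by auto
    then show ?thesis
      by (simp only: deg card_same_parity)
  qed
  have core: "c \<le> out_degree (double_star c) u" if "u < 2 * c" for u
  proof -
    have "{v. v < 2 * c \<and> (even v \<longleftrightarrow> odd u)} \<subseteq> {v. (u, v) \<in> parcs (double_star c)}"
      using that by auto
    moreover have "finite {v. (u, v) \<in> parcs (double_star c)}"
      by (rule finite_subset[of _ "{..<16 * c}"]) auto
    ultimately show ?thesis
      using card_mono card_same_parity by (metis deg)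
  qed
  show ?thesis
    unfolding min_degree_def
  proof (rule Min_eqI)
    fix k assume "k \<in> out_degree (double_star c) ` verts (double_star c)"
    then show "c \<le> k"
      using leaf core by (auto simp: not_less) (metis le_refl not_less)
  next
    show "c \<in> out_degree (double_star c) ` verts (double_star c)"
      using assms leaf[of "2 * c"] by (force intro: rev_image_eqI[of "2 * c"])
  qed simp
qed

lemma strongly_non_stackable_double_star:
  assumes "c \<ge> 1"
  shows "strongly_non_stackable (double_star c)"
  unfolding strongly_non_stackable_def
proof
  interpret pair_graph "double_star c"
    by (rule pair_graph_double_star)
  fix t assume t: "t \<in> verts (double_star c)"
  \<comment> \<open>The leaves in the half opposite to \<open>t\<close>: arcs between halves join
    core vertices only, so none of these leaves is adjacent to \<open>t\<close>. As a difference of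
    two parity classes, \<open>L\<close> has \<open>8 * c - c\<close> elements.\<close>
  define L where "L = {v. v < 16 * c \<and> (even v \<longleftrightarrow> odd t)} - {v. v < 2 * c \<and> (even v \<longleftrightarrow> odd t)}"
  have "card L = card {v. v < 2 * (8 * c) \<and> (even v \<longleftrightarrow> odd t)}
    - card {v. v < 2 * c \<and> (even v \<longleftrightarrow> odd t)}"
    unfolding L_def by (subst card_Diff_subset) auto
  then have card_L: "card L = 7 * c"
    by (simp only: card_same_parity)
  show "\<not> stackable (double_star c) t"
  proof (rule not_stackable_if_vertex_cover[where K = "{..<2 * c}" and D = 3 and L = L])
    fix x y assume "x \<in> pverts (double_star c)" "y \<in> pverts (double_star c)"
    then obtain p where p: "awalk x p y" "length p \<le> 3"
      using double_star_awalk[of x c y] by auto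
    have "graph_dist (double_star c) x y \<le> awalk_cost (\<lambda>_. 1) p"
      using p(1) by (rule min_cost_le_walk_cost)
    also have "\<dots> \<le> ereal (real 3)"
      using p(2) by (simp add: awalk_cost_def sum_list_triv)
    finally show "graph_dist (double_star c) x y \<le> ereal (real 3)" .
  next
    show "3 * card {..<2 * c} < card L"
      using assms card_L by simp
  qed (use t in \<open>auto simp: L_def split: if_splits\<close>)
qed

lemma connected_double_star:
  assumes "c \<ge> 1"
  shows "connected (double_star c)"
proof -
  interpret pair_graph "double_star c"
    by (rule pair_graph_double_star)
  show ?thesis
  proof (rule connectedI)
    fix u v assume "u \<in> pverts (double_star c)" "v \<in> pverts (double_star c)"
    then have "u \<rightarrow>\<^sup>*\<^bsub>double_star c\<^esub> v"
      using double_star_awalk[of u c v] by (auto simp: reachable_awalk)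
    then show "u \<rightarrow>\<^sup>*\<^bsub>mk_symmetric (double_star c)\<^esub> v"
      by (rule reachable_mk_symmetricI)
  qed (use assms in \<open>auto simp: lessThan_empty_iff\<close>)
qed

theorem theorem4p3:
  fixes c :: nat
  assumes "c \<ge> 1"
  shows "\<exists>G :: nat pair_pre_digraph.
    pair_graph G \<and> connected (with_proj G) \<and>
    min_degree (with_proj G) = c \<and> strongly_non_stackable (with_proj G)"
  using assms pair_graph_double_star connected_double_star min_degree_double_star
    strongly_non_stackable_double_star by blast

end
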